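(* The solution matrix $\mathcal{E}_{n,\tau}$ of the fully discrete lumped mass (LM) method is contractive in the maximum-norm if the stiffness matrix $\mathcal{S}$ is diagonally dominant. If $\mathcal{E}_{1,\tau}$ is contractive in the maximum-norm, then $\mathcal{S}$ is diagonally dominant.
   Context: Characteristic function. One of two cases is assumed. Case I: $P(z)=\sum_{i=1}^m b_iz^{\alpha_i}$, $m\ge1$, $0<\alpha_m<\dots<\alpha_1<1$, $b_i>0$, $b_1=1$. Case II: $P(z)=\int_0^1z^\alpha\mu(\alpha)\,d\alpha$, with $\mu\ge0$ Hölder continuous on $[0,1]$ and $\mu(0)\mu(1)>0$. Finite elements. $\Omega\subset\mathbb{R}^2$ is a bounded polygonal domain, $\mathcal{T}_h$ a triangulation of $\Omega$ (from a shape regular quasi-uniform family), $X_h\subset H_0^1(\Omega)$ the space of continuous functions that are linear on each triangle of $\mathcal{T}_h$ and vanish on $\partial\Omega$. $P_1,\dots,P_N$ are the interior nodes and $\phi_1,\dots,\phi_N$ the corresponding nodal basis. The stiffness matrix is $\mathcal{S}=(s_{ij})$, $s_{ij}=\int_\Omega\nabla\phi_j\cdot\nabla\phi_i\,dx$. In the LM method the mass matrix is $\mathcal{M}=(m_{ij})$, $m_{ij}=[\phi_j,\phi_i]$, with $[w,\chi]=\sum_{K\in\mathcal{T}_h}\frac13|K|\sum_{l=1}^3(w\chi)(P_l^K)$, where $P_1^K,P_2^K,P_3^K$ are the vertices of $K$ and $|K|$ its area; thus $\mathcal{M}$ is diagonal with positive diagonal. Set $\mathcal{H}=\mathcal{M}^{-1}\mathcal{S}$,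 and let $\mathcal{I}$ be the identity matrix. $\|V\|_\infty=\max_i|V_i|$, and a matrix $\mathcal{A}$ is contractive in the maximum-norm if $\|\mathcal{A}V\|_\infty\le\|V\|_\infty$ for all $V\in\mathbb{R}^N$. $\mathcal{S}$ is diagonally dominant if $\sum_{j\ne i}|s_{ij}|\le s_{ii}$ for $i=1,\dots,N$. Fully discrete scheme. For a time step $\tau>0$ the weights $\omega_j=\omega_j(\tau)$ are defined by $\sum_{j=0}^\infty\omega_j\xi^j=P((1-\xi)/\tau)$, so $\omega_0=P(\tau^{-1})$. The solution matrices $\mathcal{E}_{n,\tau}$ are defined by $U^n=\mathcal{E}_{n,\tau}V$, where $U^0=V$ and, for $n\ge1$, $$U^n=(\omega_0\mathcal{I}+\mathcal{H})^{-1}\Big(\sum_{j=0}^{n-1}\omega_jV-\sum_{j=1}^{n-1}\omega_{n-j}U^j\Big).$$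
   Formalization: In the second sentence, contractivity of E_{1,τ} is assumed for all time steps τ > 0; for a single fixed τ the claim is false, since E_{1,τ} tends to 0 as τ → ∞ and is then contractive on every mesh. *)

theory Defs
  imports "HOL-Analysis.Analysis"
begin

definition char_fun_multi_term :: "(real \<Rightarrow> real) \<Rightarrow> bool" where
  "char_fun_multi_term P \<longleftrightarrow>
    (\<exists>(m::nat) (\<alpha>::nat \<Rightarrow> real) (b::nat \<Rightarrow> real).
        1 \<le> m \<and>
        (\<forall>i\<in>{1..m}. 0 < \<alpha> i \<and> \<alpha> i < 1 \<and> 0 < b i) \<and>
        (\<forall>i\<in>{1..m}. \<forall>j\<in>{1..m}. i < j \<longrightarrow> \<alpha> j < \<alpha> i) \<and>
        b 1 = 1 \<and>
        (\<forall>z>0. P z = (\<Sum>i=1..m. b i * z powr \<alpha> i)))"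

definition hoelder_continuous_on :: "real set \<Rightarrow> (real \<Rightarrow> real) \<Rightarrow> bool" where
  "hoelder_continuous_on S f \<longleftrightarrow>
    (\<exists>C \<gamma>. 0 < \<gamma> \<and> \<gamma> \<le> 1 \<and> (\<forall>x\<in>S. \<forall>y\<in>S. \<bar>f x - f y\<bar> \<le> C * \<bar>x - y\<bar> powr \<gamma>))"

definition char_fun_distributed :: "(real \<Rightarrow> real) \<Rightarrow> bool" where
  "char_fun_distributed P \<longleftrightarrow>
    (\<exists>\<mu>::real \<Rightarrow> real.
        (\<forall>\<alpha>\<in>{0..1}. 0 \<le> \<mu> \<alpha>) \<and>
        hoelder_continuous_on {0..1} \<mu> \<and>
        0 < \<mu> 0 * \<mu> 1 \<and>
        (\<forall>z>0. P z = integral {0..1} (\<lambda>\<alpha>. z powr \<alpha> * \<mu> \<alpha>)))"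

text \<open>Only arguments \<open>z > 0\<close> are constrained: the weights use \<open>P\<close> at \<open>(1 - \<xi>) / \<tau>\<close> with
  \<open>\<bar>\<xi>\<bar> < 1\<close> and \<open>\<tau> > 0\<close>.\<close>

definition characteristic_function :: "(real \<Rightarrow> real) \<Rightarrow> bool" where
  "characteristic_function P \<longleftrightarrow> char_fun_multi_term P \<or> char_fun_distributed P"

text \<open>The coefficients of a power series are determined by its values on \<open>(-1, 1)\<close>, so the
  description below is unique; for a characteristic function the series exists.\<close>

definition weights :: "(real \<Rightarrow> real) \<Rightarrow> real \<Rightarrow> nat \<Rightarrow> real" where
  "weights P \<tau> = (THE \<omega>. \<forall>\<xi>. \<bar>\<xi>\<bar> < 1 \<longrightarrow> (\<lambda>j. \<omega> j * \<xi> ^ j) sums P ((1 - \<xi>) / \<tau>))"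

text \<open>The condition \<^term>\<open>interior (closure \<Omega>) = \<Omega>\<close> excludes slits and punctures; \<open>\<Omega>\<close> need be
  neither convex nor simply connected.\<close>

definition polygonal_domain :: "(real^2) set \<Rightarrow> bool" where
  "polygonal_domain \<Omega> \<longleftrightarrow>
    open \<Omega> \<and> connected \<Omega> \<and> \<Omega> \<noteq> {} \<and> bounded \<Omega> \<and> interior (closure \<Omega>) = \<Omega> \<and>
    (\<exists>E. finite E \<and> (\<forall>e\<in>E. \<exists>a b. e = closed_segment a b) \<and> frontier \<Omega> = \<Union>E)"

text \<open>\<^const>\<open>triangulation\<close> says that any two simplices meet in a (possibly empty) common face.\<close>

definition triangulation_of :: "(real^2) set \<Rightarrow> (real^2) set set \<Rightarrow> bool" where
  "triangulation_of \<Omega> \<T> \<longleftrightarrow>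
    triangulation \<T> \<and> (\<forall>K\<in>\<T>. 2 simplex K) \<and> \<Union>\<T> = closure \<Omega>"

definition shape_regular :: "(real^2) set set set \<Rightarrow> bool" where
  "shape_regular F \<longleftrightarrow>
    (\<exists>\<sigma>. \<forall>\<T>\<in>F. \<forall>K\<in>\<T>. \<exists>x r. 0 < r \<and> cball x r \<subseteq> K \<and> diameter K \<le> \<sigma> * r)"

definition quasi_uniform :: "(real^2) set set set \<Rightarrow> bool" where
  "quasi_uniform F \<longleftrightarrow>
    (\<exists>c. \<forall>\<T>\<in>F. \<forall>K\<in>\<T>. \<forall>K'\<in>\<T>. diameter K \<le> c * diameter K')"

definition vertices :: "(real^2) set \<Rightarrow> (real^2) set" where
  "vertices K = {p. p extreme_point_of K}"

definition interior_nodes :: "(real^2) set \<Rightarrow> (real^2) set set \<Rightarrow> (real^2) set" where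
  "interior_nodes \<Omega> \<T> = (\<Union>K\<in>\<T>. vertices K) \<inter> \<Omega>"

text \<open>Elements are functions on the whole plane, of which only the restriction to
  \<^term>\<open>closure \<Omega>\<close> matters.\<close>

definition fe_space :: "(real^2) set \<Rightarrow> (real^2) set set \<Rightarrow> (real^2 \<Rightarrow> real) set" where
  "fe_space \<Omega> \<T> = {u. continuous_on (closure \<Omega>) u \<and>
      (\<forall>K\<in>\<T>. \<exists>g c. linear g \<and> (\<forall>x\<in>K. u x = g x + c)) \<and>
      (\<forall>x\<in>frontier \<Omega>. u x = 0)}"

definition nodal_basis ::
  "(real^2) set \<Rightarrow> (real^2) set set \<Rightarrow> ('n \<Rightarrow> real^2) \<Rightarrow> ('n \<Rightarrow> real^2 \<Rightarrow> real) \<Rightarrow> bool" where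
  "nodal_basis \<Omega> \<T> p \<phi> \<longleftrightarrow>
    (\<forall>i. \<phi> i \<in> fe_space \<Omega> \<T>) \<and> (\<forall>i j. \<phi> i (p j) = (if i = j then 1 else 0))"

text \<open>For a finite element function the gradient exists off the edges, which are negligible.\<close>

definition gradient :: "(real^2 \<Rightarrow> real) \<Rightarrow> real^2 \<Rightarrow> real^2" where
  "gradient u x = (THE D. GDERIV u x :> D)"

definition stiffness_matrix ::
  "(real^2) set \<Rightarrow> ('n::finite \<Rightarrow> real^2 \<Rightarrow> real) \<Rightarrow> real^'n^'n" where
  "stiffness_matrix \<Omega> \<phi> =
    (\<chi> i j. integral \<Omega> (\<lambda>x. gradient (\<phi> j) x \<bullet> gradient (\<phi> i) x))"

definition lumped_inner :: "(real^2) set set \<Rightarrow> (real^2 \<Rightarrow> real) \<Rightarrow> (real^2 \<Rightarrow> real) \<Rightarrow> real" where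
  "lumped_inner \<T> w v =
    (\<Sum>K\<in>\<T>. 1 / 3 * measure lebesgue K * (\<Sum>q\<in>vertices K. w q * v q))"

definition LM_mass_matrix ::
  "(real^2) set set \<Rightarrow> ('n::finite \<Rightarrow> real^2 \<Rightarrow> real) \<Rightarrow> real^'n^'n" where
  "LM_mass_matrix \<T> \<phi> = (\<chi> i j. lumped_inner \<T> (\<phi> j) (\<phi> i))"

definition LM_matrix ::
  "(real^2) set \<Rightarrow> (real^2) set set \<Rightarrow> ('n::finite \<Rightarrow> real^2 \<Rightarrow> real) \<Rightarrow> real^'n^'n" where
  "LM_matrix \<Omega> \<T> \<phi> = matrix_inv (LM_mass_matrix \<T> \<phi>) ** stiffness_matrix \<Omega> \<phi>"

fun discrete_solution ::
  "(nat \<Rightarrow> real) \<Rightarrow> real^'n^'n \<Rightarrow> real^'n \<Rightarrow> nat \<Rightarrow> real^'n::finite" where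
  "discrete_solution \<omega> H V n =
    (if n = 0 then V
     else matrix_inv (\<omega> 0 *\<^sub>R mat 1 + H) *v
       ((\<Sum>j=0..n-1. \<omega> j *\<^sub>R V) - (\<Sum>j\<in>{1..<n}. \<omega> (n - j) *\<^sub>R discrete_solution \<omega> H V j)))"

declare discrete_solution.simps [simp del]

text \<open>The discrete solution depends linearly on \<open>V\<close>, so this is the matrix that represents the
  map \<open>V \<mapsto> U\<^sup>n\<close>.\<close>

definition solution_matrix :: "(nat \<Rightarrow> real) \<Rightarrow> real^'n^'n \<Rightarrow> nat \<Rightarrow> real^'n^'n::finite" where
  "solution_matrix \<omega> H n = matrix (\<lambda>V. discrete_solution \<omega> H V n)"

text \<open>On \<open>real^'n\<close> the library's \<^const>\<open>infnorm\<close> is the maximum of the moduli of the components.\<close>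

definition max_norm_contractive :: "real^'n^'n::finite \<Rightarrow> bool" where
  "max_norm_contractive A \<longleftrightarrow> (\<forall>V. infnorm (A *v V) \<le> infnorm V)"

definition diagonally_dominant :: "real^'n^'n::finite \<Rightarrow> bool" where
  "diagonally_dominant A \<longleftrightarrow> (\<forall>i. (\<Sum>j\<in>UNIV - {i}. \<bar>A $ i $ j\<bar>) \<le> A $ i $ i)"

end

(* The lumped mass matrix is diagonal with positive diagonal, so S is diagonally dominant iff
   H = M^-1 S is. If H is diagonally dominant, evaluating
   (c I + H) x at a component where |x_i| is maximal gives c |x| <= |(c I + H) x|. As omega_0 > 0,
   omega_j <= 0 for j > 0 and the partial sums of the weights are nonnegative, the moduli of the
   coefficients in the recursion for U^n add up to omega_0, and contractivity follows by induction.

   Conversely, omega_0 = P(1/tau) is unbounded as tau -> 0. Test contractivity of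
   E_1 = omega_0 (omega_0 I + H)^-1 on the image under omega_0 I + H of the vector with
   x_i = 1, x_j = - r sgn h_ij for j ~= i, where r < 1: for large omega_0 the maximum norm of
   (omega_0 I + H) x is attained at i, which gives r sum_{j ~= i} |h_ij| <= h_ii; let r -> 1. *)

theory Submission
  imports Defs "HOL-Complex_Analysis.Cauchy_Integral_Formula"
begin

section \<open>Resolvents of diagonally dominant matrices\<close>

lemma infnorm_le_cart:
  fixes x :: "real^'n"
  assumes "\<And>i. \<bar>x $ i\<bar> \<le> c"
  shows "infnorm x \<le> c"
  unfolding infnorm_cart by (rule cSup_least) (use assms in auto)

lemma infnorm_attained_cart:
  fixes x :: "real^'n"
  obtains i where "infnorm x = \<bar>x $ i\<bar>"
proof -
  have "Max (range (\<lambda>i. \<bar>x $ i\<bar>)) \<in> range (\<lambda>i. \<bar>x $ i\<bar>)"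
    by (rule Max_in) auto
  then obtain i where i: "Max (range (\<lambda>i. \<bar>x $ i\<bar>)) = \<bar>x $ i\<bar>" by blast
  then have "\<bar>x $ j\<bar> \<le> \<bar>x $ i\<bar>" for j
    by (metis Max_ge finite finite_imageI rangeI)
  then have "infnorm x = \<bar>x $ i\<bar>"
    by (intro antisym infnorm_le_cart component_le_infnorm_cart)
  then show thesis by (rule that)
qed

lemma infnorm_sum: "infnorm (\<Sum>i\<in>I. f i) \<le> (\<Sum>i\<in>I. infnorm (f i))"
proof (induction I rule: infinite_finite_induct)
  case (insert i I)
  then show ?case
    using infnorm_triangle[of "f i" "sum f I"] by simp
qed (simp_all add: infnorm_0)

lemma shifted_matrix_vector_nth:
  fixes A :: "real^'n^'n"
  shows "((c *\<^sub>R mat 1 + A) *v x) $ i = c * x $ i + (\<Sum>j\<in>UNIV. A $ i $ j * x $ j)"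
proof -
  have "(c *\<^sub>R mat 1 + A) *v x = c *\<^sub>R x + A *v x"
    by (simp add: matrix_vector_mult_add_rdistrib flip: scaleR_matrix_vector_assoc)
  then show ?thesis by (simp add: matrix_vector_mult_def)
qed

text \<open>Where |x_i| is maximal, the off-diagonal part of row i is at most
  \<open>A $ i $ i\<close> times |x_i|. It can cancel the contribution of the diagonal entry, but
  not that of the shift \<open>c\<close>.\<close>

lemma diagonally_dominant_infnorm_lower:
  fixes A :: "real^'n^'n"
  assumes A: "diagonally_dominant A" and c: "0 \<le> c"
  shows "c * infnorm x \<le> infnorm ((c *\<^sub>R mat 1 + A) *v x)"
proof -
  obtain i where i: "infnorm x = \<bar>x $ i\<bar>" by (rule infnorm_attained_cart)
  define s where "s = (\<Sum>j\<in>UNIV - {i}. A $ i $ j * x $ j)"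
  have le: "(\<Sum>j\<in>UNIV - {i}. \<bar>A $ i $ j\<bar>) \<le> A $ i $ i"
    using A by (simp add: diagonally_dominant_def)
  then have Aii: "0 \<le> A $ i $ i" by (meson abs_ge_zero order_trans sum_nonneg)
  have "\<bar>s\<bar> \<le> (\<Sum>j\<in>UNIV - {i}. \<bar>A $ i $ j\<bar> * infnorm x)"
    unfolding s_def
    by (rule order_trans[OF sum_abs])
      (auto simp: abs_mult intro!: sum_mono mult_left_mono component_le_infnorm_cart)
  also have "\<dots> = (\<Sum>j\<in>UNIV - {i}. \<bar>A $ i $ j\<bar>) * infnorm x"
    by (simp add: sum_distrib_right)
  also have "\<dots> \<le> A $ i $ i * \<bar>x $ i\<bar>"
    using le by (simp add: i mult_right_mono)
  finally have s: "\<bar>s\<bar> \<le> A $ i $ i * \<bar>x $ i\<bar>" .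
  have "((c *\<^sub>R mat 1 + A) *v x) $ i = (c + A $ i $ i) * x $ i + s"
    unfolding shifted_matrix_vector_nth s_def
    by (subst sum.remove[of UNIV i]) (simp_all add: algebra_simps)
  moreover have "\<bar>(c + A $ i $ i) * x $ i\<bar> = c * \<bar>x $ i\<bar> + A $ i $ i * \<bar>x $ i\<bar>"
    using c Aii unfolding abs_mult by (simp add: distrib_right)
  ultimately have "c * \<bar>x $ i\<bar> \<le> \<bar>((c *\<^sub>R mat 1 + A) *v x) $ i\<bar>"
    using s by linarith
  also have "\<dots> \<le> infnorm ((c *\<^sub>R mat 1 + A) *v x)"
    by (rule component_le_infnorm_cart)
  finally show ?thesis unfolding i .
qed

lemma matrix_inv_works:
  fixes A :: "'a::field^'n^'n"
  assumes "invertible A"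
  shows "A ** matrix_inv A = mat 1" "matrix_inv A ** A = mat 1"
proof -
  have "A ** matrix_inv A = mat 1 \<and> matrix_inv A ** A = mat 1"
    unfolding matrix_inv_def using assms unfolding invertible_def by (rule someI_ex)
  then show "A ** matrix_inv A = mat 1" "matrix_inv A ** A = mat 1" by auto
qed

text \<open>For a positive shift the lower bound leaves only the zero vector in the kernel.\<close>

lemma diagonally_dominant_shift_invertible:
  fixes A :: "real^'n^'n"
  assumes "diagonally_dominant A" "0 < c"
  shows "invertible (c *\<^sub>R mat 1 + A)"
proof -
  have "x = 0" if "(c *\<^sub>R mat 1 + A) *v x = 0" for x
    using diagonally_dominant_infnorm_lower[OF assms(1), of c x] assms(2) that
      infnorm_pos_le[of x]
    by (simp add: infnorm_0 mult_le_0_iff infnorm_eq_0)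
  then show ?thesis
    by (simp add: invertible_left_inverse matrix_left_invertible_ker)
qed

lemma diagonally_dominant_resolvent_bound:
  fixes A :: "real^'n^'n"
  assumes "diagonally_dominant A" "0 < c"
  shows "c * infnorm (matrix_inv (c *\<^sub>R mat 1 + A) *v x) \<le> infnorm x"
  using diagonally_dominant_infnorm_lower[of A c "matrix_inv (c *\<^sub>R mat 1 + A) *v x"] assms
  by (simp add: matrix_vector_mul_assoc matrix_inv_works diagonally_dominant_shift_invertible)

text \<open>For arbitrary \<open>A\<close>, a shift by the sum \<open>C\<close> of the moduli of all
  entries produces a diagonally dominant matrix; the remaining shift \<open>c - C\<close> is
  positive.\<close>

lemma large_shift_invertible:
  fixes A :: "real^'n^'n"
  assumes c: "(\<Sum>i\<in>UNIV. \<Sum>j\<in>UNIV. \<bar>A $ i $ j\<bar>) < c"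
  shows "invertible (c *\<^sub>R mat 1 + A)"
proof -
  define C where "C = (\<Sum>i\<in>UNIV. \<Sum>j\<in>UNIV. \<bar>A $ i $ j\<bar>)"
  have "diagonally_dominant (C *\<^sub>R mat 1 + A)"
    unfolding diagonally_dominant_def
  proof
    fix i
    have "(\<Sum>j\<in>UNIV - {i}. \<bar>A $ i $ j\<bar>) + \<bar>A $ i $ i\<bar> = (\<Sum>j\<in>UNIV. \<bar>A $ i $ j\<bar>)"
      by (simp add: sum.remove[of UNIV i])
    also have "\<dots> \<le> C"
      unfolding C_def by (rule member_le_sum) (auto intro: sum_nonneg)
    finally have "(\<Sum>j\<in>UNIV - {i}. \<bar>A $ i $ j\<bar>) \<le> C + A $ i $ i" by linarith
    moreover have "(\<Sum>j\<in>UNIV - {i}. \<bar>(C *\<^sub>R mat 1 + A) $ i $ j\<bar>) = (\<Sum>j\<in>UNIV - {i}. \<bar>A $ i $ j\<bar>)"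
      by (rule sum.cong) (auto simp: mat_def)
    ultimately show "(\<Sum>j\<in>UNIV - {i}. \<bar>(C *\<^sub>R mat 1 + A) $ i $ j\<bar>) \<le> (C *\<^sub>R mat 1 + A) $ i $ i"
      by (simp add: mat_def)
  qed
  then have "invertible ((c - C) *\<^sub>R mat 1 + (C *\<^sub>R mat 1 + A))"
    by (rule diagonally_dominant_shift_invertible) (use c in \<open>simp add: C_def\<close>)
  then show ?thesis by (simp add: algebra_simps)
qed

text \<open>The hypothesis asks for arbitrarily large shifts \<open>c\<close>, which is what
  \<omega>_0 = P(1/\<tau>) supplies as \<tau> tends to 0.\<close>

lemma diagonally_dominant_if_resolvents_contractive:
  fixes A :: "real^'n^'n"
  assumes contr: "\<And>B. \<exists>c>B. \<forall>V. infnorm (matrix_inv (c *\<^sub>R mat 1 + A) *v (c *\<^sub>R V)) \<le> infnorm V"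
  shows "diagonally_dominant A"
  unfolding diagonally_dominant_def
proof
  fix i
  define C where "C = (\<Sum>i\<in>UNIV. \<Sum>j\<in>UNIV. \<bar>A $ i $ j\<bar>)"
  have row: "(\<Sum>j\<in>UNIV. \<bar>A $ k $ j\<bar>) \<le> C" for k
    unfolding C_def by (rule member_le_sum) (auto intro: sum_nonneg)
  have C0: "0 \<le> C" unfolding C_def by (intro sum_nonneg) auto
  show "(\<Sum>j\<in>UNIV - {i}. \<bar>A $ i $ j\<bar>) \<le> A $ i $ i"
  proof (rule field_le_mult_one_interval)
    fix r :: real assume r: "0 < r" "r < 1"
    \<comment> \<open>c > C gives invertibility and later fixes a sign; c > C / (1 - r) gives rc + C
      < c, which keeps every row other than i below c.\<close>
    obtain c where c: "c > max C (C / (1 - r))"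
      and con: "\<And>V. infnorm (matrix_inv (c *\<^sub>R mat 1 + A) *v (c *\<^sub>R V)) \<le> infnorm V"
      using contr[of "max C (C / (1 - r))"] by blast
    have cpos: "c > 0" "c > C" using c C0 by auto
    have rc: "r * c + C < c" using c r by (simp add: field_simps)
    \<comment> \<open>Row i of \<open>A\<close> maps \<open>W\<close> to a_ii - r * (sum of |a_ij|
      over j \<noteq> i), the quantity whose nonnegativity is wanted.\<close>
    define W where "W = (\<chi> j. if j = i then 1 else - r * sgn (A $ i $ j))"
    define B where "B = c *\<^sub>R mat 1 + A"
    have B: "invertible B"
      unfolding B_def using cpos by (intro large_shift_invertible) (simp add: C_def)
    have W1: "\<bar>W $ k\<bar> \<le> 1" for k
      using r by (auto simp: W_def abs_mult sgn_if)
    \<comment> \<open>The test vector is (1/c) B W, whose image is W; contractivity then reads c |W|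
      \<le> |B W|.\<close>
    have "matrix_inv B *v (c *\<^sub>R ((1 / c) *\<^sub>R (B *v W))) = W"
      using cpos B by (simp add: matrix_vector_mul_assoc matrix_inv_works)
    then have "infnorm W \<le> infnorm ((1 / c) *\<^sub>R (B *v W))"
      using con unfolding B_def by metis
    then have "c * infnorm W \<le> infnorm (B *v W)"
      using cpos by (simp add: infnorm_mul field_simps)
    moreover have "1 \<le> infnorm W"
      using component_le_infnorm_cart[of W i] by (simp add: W_def)
    ultimately have cB: "c \<le> infnorm (B *v W)"
      using cpos mult_left_mono[of 1 "infnorm W" c] by linarith
    obtain k where k: "infnorm (B *v W) = \<bar>(B *v W) $ k\<bar>" by (rule infnorm_attained_cart)
    have AW: "\<bar>\<Sum>j\<in>UNIV. A $ k $ j * W $ j\<bar> \<le> C"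
    proof -
      have "\<bar>\<Sum>j\<in>UNIV. A $ k $ j * W $ j\<bar> \<le> (\<Sum>j\<in>UNIV. \<bar>A $ k $ j\<bar>)"
        by (rule order_trans[OF sum_abs])
          (auto simp: abs_mult intro!: sum_mono mult_left_le W1)
      with row show ?thesis by (meson order_trans)
    qed
    have BW: "(B *v W) $ k = c * W $ k + (\<Sum>j\<in>UNIV. A $ k $ j * W $ j)"
      unfolding B_def by (rule shifted_matrix_vector_nth)
    \<comment> \<open>In any other row |W_k| \<le> r, so that component of B W is at most rc + C < c
      in modulus and cannot be the maximum.\<close>
    have "k = i"
    proof (rule ccontr)
      assume "k \<noteq> i"
      then have "\<bar>W $ k\<bar> \<le> r" using r by (auto simp: W_def abs_mult sgn_if)
      then have "\<bar>c * W $ k\<bar> \<le> r * c" using cpos by (simp add: abs_mult)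
      then show False using AW BW rc cB k by linarith
    qed
    then have "c \<le> \<bar>c + (\<Sum>j\<in>UNIV. A $ i $ j * W $ j)\<bar>"
      using cB k BW by (simp add: W_def)
    then have "0 \<le> (\<Sum>j\<in>UNIV. A $ i $ j * W $ j)"
      using AW cpos \<open>k = i\<close> by (auto simp: abs_if split: if_splits)
    also have "\<dots> = A $ i $ i + (\<Sum>j\<in>UNIV - {i}. A $ i $ j * W $ j)"
      by (simp add: sum.remove[of UNIV i] W_def)
    also have "(\<Sum>j\<in>UNIV - {i}. A $ i $ j * W $ j) = (\<Sum>j\<in>UNIV - {i}. - (r * \<bar>A $ i $ j\<bar>))"
      by (rule sum.cong) (auto simp: W_def abs_sgn mult_ac)
    finally show "r * (\<Sum>j\<in>UNIV - {i}. \<bar>A $ i $ j\<bar>) \<le> A $ i $ i"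
      by (simp add: sum_negf sum_distrib_left)
  qed
qed

section \<open>The time stepping scheme\<close>

lemma discrete_solution_0 [simp]: "discrete_solution \<omega> H V 0 = V"
  by (simp add: discrete_solution.simps)

lemma discrete_solution_1:
  "discrete_solution \<omega> H V 1 = matrix_inv (\<omega> 0 *\<^sub>R mat 1 + H) *v (\<omega> 0 *\<^sub>R V)"
  by (simp add: discrete_solution.simps)

text \<open>Needed for \<open>solution_matrix\<close> to represent the map from V to U^n. Each step
  applies a fixed matrix to a linear combination of V and earlier iterates.\<close>

lemma linear_discrete_solution: "linear (\<lambda>V. discrete_solution \<omega> H V n)"
proof (induction n rule: less_induct)
  case (less n)
  show ?case
  proof (cases "n = 0")
    case False
    have "linear (\<lambda>V. (\<Sum>j=0..n-1. \<omega> j *\<^sub>R V)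
        - (\<Sum>j\<in>{1..<n}. \<omega> (n - j) *\<^sub>R discrete_solution \<omega> H V j))"
      by (intro linear_compose_sub linear_compose_sum linear_compose_scale_right ballI less)
        (auto simp: linear_iff algebra_simps)
    from linear_compose[OF this matrix_vector_mul_linear[of "matrix_inv (\<omega> 0 *\<^sub>R mat 1 + H)"]]
    show ?thesis
      using False by (subst discrete_solution.simps) (simp add: o_def)
  qed (simp add: linear_iff)
qed

lemma solution_matrix_works: "solution_matrix \<omega> H n *v V = discrete_solution \<omega> H V n"
  unfolding solution_matrix_def
  by (rule matrix_works) (simp add: linear_matrix_vector_mul_eq linear_discrete_solution)

text \<open>In the right-hand side for U^n, V has the coefficient \<omega>_0 + ... + \<omega>_{n-1}
  \<ge> 0 and the earlier iterates have coefficients of moduli -\<omega>_1, ..., -\<omega>_{n-1}.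
  The total collapses to \<omega>_0, which the resolvent bound divides out.\<close>

lemma infnorm_discrete_solution_le:
  fixes H :: "real^'n^'n"
  assumes H: "diagonally_dominant H" and \<omega>0: "0 < \<omega> 0"
    and neg: "\<And>j. 0 < j \<Longrightarrow> \<omega> j \<le> 0" and part: "\<And>n. 0 \<le> (\<Sum>j\<le>n. \<omega> j)"
  shows "infnorm (discrete_solution \<omega> H V n) \<le> infnorm V"
proof (induction n rule: less_induct)
  case (less n)
  show ?case
  proof (cases n)
    case (Suc m)
    define R where "R = (\<Sum>j=0..m. \<omega> j *\<^sub>R V)
        - (\<Sum>j\<in>{1..<Suc m}. \<omega> (Suc m - j) *\<^sub>R discrete_solution \<omega> H V j)"
    have "infnorm (\<Sum>j=0..m. \<omega> j *\<^sub>R V) = (\<Sum>j\<le>m. \<omega> j) * infnorm V"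
      using part[of m] by (simp add: atMost_atLeast0 infnorm_mul flip: scaleR_left.sum)
    moreover have "infnorm (\<Sum>j\<in>{1..<Suc m}. \<omega> (Suc m - j) *\<^sub>R discrete_solution \<omega> H V j)
        \<le> (\<Sum>j\<in>{1..<Suc m}. - \<omega> (Suc m - j) * infnorm V)"
    proof (rule order_trans[OF infnorm_sum], rule sum_mono)
      fix j assume j: "j \<in> {1..<Suc m}"
      then have "infnorm (discrete_solution \<omega> H V j) \<le> infnorm V"
        using less Suc by auto
      moreover have "\<omega> (Suc m - j) \<le> 0" using j by (intro neg) auto
      ultimately show "infnorm (\<omega> (Suc m - j) *\<^sub>R discrete_solution \<omega> H V j)
          \<le> - \<omega> (Suc m - j) * infnorm V"
        unfolding infnorm_mul by (simp add: mult_left_mono_neg)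
    qed
    ultimately have "infnorm R \<le> (\<Sum>j\<le>m. \<omega> j) * infnorm V
        + (\<Sum>j\<in>{1..<Suc m}. - \<omega> (Suc m - j) * infnorm V)"
      unfolding R_def diff_conv_add_uminus
      by (intro order_trans[OF infnorm_triangle] add_mono) (simp_all add: infnorm_neg)
    \<comment> \<open>Reversing the order of summation aligns the history weights with the partial
      sum, so that all terms except j = 0 cancel.\<close>
    also have "(\<Sum>j\<in>{1..<Suc m}. - \<omega> (Suc m - j) * infnorm V) = (\<Sum>j\<in>{1..m}. - \<omega> j * infnorm V)"
      by (rule sum.reindex_bij_witness[of _ "\<lambda>j. Suc m - j" "\<lambda>j. Suc m - j"]) auto
    also have "(\<Sum>j\<le>m. \<omega> j) * infnorm V + \<dots> = \<omega> 0 * infnorm V"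
      by (simp add: atMost_atLeast0 sum.atLeast_Suc_atMost sum_negf distrib_right
          flip: sum_distrib_right)
    finally have "infnorm R \<le> \<omega> 0 * infnorm V" .
    with diagonally_dominant_resolvent_bound[OF H \<omega>0, of R]
    have "\<omega> 0 * infnorm (matrix_inv (\<omega> 0 *\<^sub>R mat 1 + H) *v R) \<le> \<omega> 0 * infnorm V"
      by linarith
    then have "infnorm (matrix_inv (\<omega> 0 *\<^sub>R mat 1 + H) *v R) \<le> infnorm V"
      using \<omega>0 by simp
    moreover have "discrete_solution \<omega> H V n = matrix_inv (\<omega> 0 *\<^sub>R mat 1 + H) *v R"
      by (subst discrete_solution.simps) (simp add: R_def Suc)
    ultimately show ?thesis by simp
  qed simp
qed

section \<open>The convolution weights\<close>

text \<open>Makes the \<open>THE\<close> in \<open>weights\<close> well defined. A nonzero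
  coefficient of the difference would make its zero at 0 isolated, yet the difference vanishes on
  the whole interval.\<close>

lemma power_series_unique_unit_interval:
  fixes a b :: "nat \<Rightarrow> real"
  assumes a: "\<And>x. \<bar>x\<bar> < 1 \<Longrightarrow> (\<lambda>n. a n * x ^ n) sums f x"
    and b: "\<And>x. \<bar>x\<bar> < 1 \<Longrightarrow> (\<lambda>n. b n * x ^ n) sums f x"
  shows "a = b"
proof
  fix m
  have d: "(\<lambda>n. (a n - b n) * (x - 0) ^ n) sums (\<lambda>_. 0) x" if "norm (x - 0) < 1" for x
    using sums_diff[OF a[of x] b[of x]] that by (simp add: algebra_simps)
  show "a m = b m"
  \<comment> \<open>\<open>powser_0_nonzero\<close> concerns coefficients of positive index; the
    constant term is read off at x = 0.\<close>
  proof (cases "m = 0")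
    case True
    then show ?thesis using a[of 0] b[of 0] by simp
  next
    case False
    show ?thesis
    proof (rule ccontr)
      assume "a m \<noteq> b m"
      then obtain s where "0 < s" and "\<And>z::real. z \<in> cball 0 s - {0} \<Longrightarrow> (\<lambda>_. 0::real) z \<noteq> 0"
        using powser_0_nonzero[of 1 0 "\<lambda>n. a n - b n" "\<lambda>_. 0" m] d False by auto
      from this(2)[of s] \<open>0 < s\<close> show False by simp
    qed
  qed
qed

section \<open>Binomial weights: the Taylor coefficients of (1 - x)^\<alpha>, that is, the weights
  of P(z) = z^\<alpha> for \<tau> = 1\<close>

definition binomial_weight :: "real \<Rightarrow> nat \<Rightarrow> real" where
  "binomial_weight \<alpha> j = (-1) ^ j * (\<alpha> gchoose j)"

lemma binomial_weight_0 [simp]: "binomial_weight \<alpha> 0 = 1"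
  by (simp add: binomial_weight_def)

text \<open>Sign, size and continuity in \<alpha> all follow from this ratio by induction.\<close>

lemma binomial_weight_Suc:
  "binomial_weight \<alpha> (Suc j) = binomial_weight \<alpha> j * ((real j - \<alpha>) / (real j + 1))"
  by (simp add: binomial_weight_def gbinomial_prod_rev field_simps)

text \<open>The weight of index 1 is -\<alpha>, and from there on the ratios (j - \<alpha>) / (j +
  1) are nonnegative because \<alpha> \<le> 1 \<le> j.\<close>

lemma binomial_weight_nonpos:
  assumes "0 \<le> \<alpha>" "\<alpha> \<le> 1" "0 < j"
  shows "binomial_weight \<alpha> j \<le> 0"
  using \<open>0 < j\<close>
proof (induction j rule: nat_induct_non_zero)
  case 1
  then show ?case using assms binomial_weight_Suc[of \<alpha> 0] by simp
next
  case (Suc j)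
  then show ?case
    using assms unfolding binomial_weight_Suc
    by (intro mult_nonpos_nonneg divide_nonneg_nonneg) auto
qed

text \<open>A bound uniform in \<alpha>, used to interchange series and integral in Case II. Every
  ratio has modulus at most 1.\<close>

lemma abs_binomial_weight_le_1:
  assumes "0 \<le> \<alpha>" "\<alpha> \<le> 1"
  shows "\<bar>binomial_weight \<alpha> j\<bar> \<le> 1"
proof (induction j)
  case (Suc j)
  have "\<bar>(real j - \<alpha>) / (real j + 1)\<bar> \<le> 1" using assms by (auto simp: abs_le_iff field_simps)
  with Suc show ?case unfolding binomial_weight_Suc abs_mult by (intro mult_le_one) auto
qed simp

lemma continuous_on_binomial_weight [continuous_intros]:
  "continuous_on S (\<lambda>\<alpha>. binomial_weight \<alpha> j)"
  by (induction j) (auto simp: binomial_weight_Suc intro!: continuous_intros)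

lemma binomial_weight_sums:
  assumes "\<bar>x\<bar> < 1"
  shows "(\<lambda>j. binomial_weight \<alpha> j * x ^ j) sums (1 - x) powr \<alpha>"
  using gen_binomial_real[of "- x" \<alpha>] assms
  by (simp add: binomial_weight_def power_minus[of x] mult_ac)

text \<open>The property under the \<open>THE\<close> in \<open>weights\<close>, stated as a
  predicate so that an explicit sequence can be checked against it and then identified with the
  weights.\<close>

definition generating_weights :: "(real \<Rightarrow> real) \<Rightarrow> real \<Rightarrow> (nat \<Rightarrow> real) \<Rightarrow> bool" where
  "generating_weights P \<tau> \<omega> \<longleftrightarrow> (\<forall>\<xi>. \<bar>\<xi>\<bar> < 1 \<longrightarrow> (\<lambda>j. \<omega> j * \<xi> ^ j) sums P ((1 - \<xi>) / \<tau>))"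

lemma weights_eqI:
  assumes "generating_weights P \<tau> \<omega>"
  shows "weights P \<tau> = \<omega>"
  unfolding weights_def
proof (rule the_equality)
  show "\<forall>\<xi>. \<bar>\<xi>\<bar> < 1 \<longrightarrow> (\<lambda>j. \<omega> j * \<xi> ^ j) sums P ((1 - \<xi>) / \<tau>)"
    using assms by (simp add: generating_weights_def)
  then show "\<omega>' = \<omega>" if "\<forall>\<xi>. \<bar>\<xi>\<bar> < 1 \<longrightarrow> (\<lambda>j. \<omega>' j * \<xi> ^ j) sums P ((1 - \<xi>) / \<tau>)" for \<omega>'
    using that by (intro power_series_unique_unit_interval) auto
qed

lemma generating_weights_0:
  assumes "generating_weights P \<tau> \<omega>"
  shows "\<omega> 0 = P (1 / \<tau>)"
proof -
  have "(\<lambda>j. \<omega> j * 0 ^ j) sums P ((1 - 0) / \<tau>)"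
    using assms unfolding generating_weights_def by (metis abs_zero zero_less_one)
  then show ?thesis by simp
qed

text \<open>Abel summation in the limit \<open>\<xi> \<longrightarrow> 1\<close>: dropping the nonpositive tail only increases the sum.\<close>

lemma generating_weights_partial_sum_nonneg:
  assumes gen: "generating_weights P \<tau> \<omega>" and \<tau>: "0 < \<tau>"
    and P: "\<And>z. 0 < z \<Longrightarrow> 0 \<le> P z" and neg: "\<And>j. 0 < j \<Longrightarrow> \<omega> j \<le> 0"
  shows "0 \<le> (\<Sum>j\<le>n. \<omega> j)"
proof -
  have ge: "0 \<le> (\<Sum>j\<le>n. \<omega> j * \<xi> ^ j)" if "0 \<le> \<xi>" "\<xi> < 1" for \<xi>
  proof -
    have s: "(\<lambda>j. \<omega> j * \<xi> ^ j) sums P ((1 - \<xi>) / \<tau>)"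
      using gen that by (simp add: generating_weights_def)
    \<comment> \<open>After negation all terms beyond n are nonnegative, so the partial sum is at
      most the full sum -P((1 - \<xi>)/\<tau>) \<le> 0.\<close>
    have "(\<lambda>j. - (\<omega> j * \<xi> ^ j)) sums - P ((1 - \<xi>) / \<tau>)"
      by (rule sums_minus[OF s])
    then have "summable (\<lambda>j. - (\<omega> j * \<xi> ^ j))" "suminf (\<lambda>j. - (\<omega> j * \<xi> ^ j)) = - P ((1 - \<xi>) / \<tau>)"
      by (auto simp: sums_iff)
    moreover have "(\<Sum>j\<le>n. - (\<omega> j * \<xi> ^ j)) \<le> suminf (\<lambda>j. - (\<omega> j * \<xi> ^ j))"
    proof (rule sum_le_suminf)
      fix j assume "j \<in> - {..n}"
      then show "0 \<le> - (\<omega> j * \<xi> ^ j)"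
        using neg[of j] that by (auto simp: mult_le_0_iff)
    qed (use \<open>summable (\<lambda>j. - (\<omega> j * \<xi> ^ j))\<close> in auto)
    moreover have "0 \<le> P ((1 - \<xi>) / \<tau>)" using that \<tau> by (intro P) auto
    ultimately show ?thesis by (simp add: sum_negf)
  qed
  have "((\<lambda>\<xi>. \<Sum>j\<le>n. \<omega> j * \<xi> ^ j) \<longlongrightarrow> (\<Sum>j\<le>n. \<omega> j * 1 ^ j)) (at_left 1)"
    by (intro tendsto_intros)
  moreover have "\<forall>\<^sub>F \<xi> in at_left (1::real). 0 \<le> (\<Sum>j\<le>n. \<omega> j * \<xi> ^ j)"
    using eventually_at_left_real[OF zero_less_one] by (rule eventually_mono) (auto intro: ge)
  ultimately have "0 \<le> (\<Sum>j\<le>n. \<omega> j * 1 ^ j)"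
    by (rule tendsto_lowerbound) simp
  then show ?thesis by simp
qed

section \<open>Existence and sign of the weights in Cases I and II\<close>

lemma hoelder_continuous_on_imp_continuous_on:
  assumes "hoelder_continuous_on S f"
  shows "continuous_on S f"
proof -
  obtain C g where g: "0 < g" and H: "\<And>x y. x \<in> S \<Longrightarrow> y \<in> S \<Longrightarrow> \<bar>f x - f y\<bar> \<le> C * \<bar>x - y\<bar> powr g"
    using assms unfolding hoelder_continuous_on_def by blast
  show ?thesis
    unfolding continuous_on_def
  proof
    fix x assume x: "x \<in> S"
    have "((\<lambda>y. C * \<bar>y - x\<bar> powr g) \<longlongrightarrow> C * \<bar>x - x\<bar> powr g) (at x within S)"
      using g by (intro tendsto_intros tendsto_powr') auto
    then have "((\<lambda>y. C * \<bar>y - x\<bar> powr g) \<longlongrightarrow> 0) (at x within S)" by simp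
    then have "((\<lambda>y. f y - f x) \<longlongrightarrow> 0) (at x within S)"
      by (rule Lim_null_comparison[rotated]) (use H x in \<open>auto simp: eventually_at_filter\<close>)
    then show "(f \<longlongrightarrow> f x) (at x within S)" by (simp add: LIM_zero_iff)
  qed
qed

text \<open>The weights depend linearly on P: they are combinations of binomial weights with the
  positive coefficients b_i \<tau>^(-\<alpha>_i).\<close>

lemma multi_term_generating_weights:
  assumes "char_fun_multi_term P" and \<tau>: "0 < \<tau>"
  shows "\<exists>\<omega>. generating_weights P \<tau> \<omega> \<and> (\<forall>j>0. \<omega> j \<le> 0)"
proof -
  obtain m and \<alpha> b :: "nat \<Rightarrow> real" where
    ab: "\<forall>i\<in>{1..m}. 0 < \<alpha> i \<and> \<alpha> i < 1 \<and> 0 < b i"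
    and P: "\<forall>z>0. P z = (\<Sum>i=1..m. b i * z powr \<alpha> i)"
    using assms unfolding char_fun_multi_term_def by blast
  define \<omega> where "\<omega> j = (\<Sum>i=1..m. b i / \<tau> powr \<alpha> i * binomial_weight (\<alpha> i) j)" for j
  have "(\<lambda>j. \<omega> j * \<xi> ^ j) sums P ((1 - \<xi>) / \<tau>)" if \<xi>: "\<bar>\<xi>\<bar> < 1" for \<xi>
  proof -
    have "(\<lambda>j. \<Sum>i=1..m. b i / \<tau> powr \<alpha> i * (binomial_weight (\<alpha> i) j * \<xi> ^ j)) sums
        (\<Sum>i=1..m. b i / \<tau> powr \<alpha> i * (1 - \<xi>) powr \<alpha> i)"
      by (intro sums_sum sums_mult binomial_weight_sums \<xi>)
    moreover have "(\<Sum>i=1..m. b i / \<tau> powr \<alpha> i * (1 - \<xi>) powr \<alpha> i) = P ((1 - \<xi>) / \<tau>)"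
      using \<xi> \<tau> P by (simp add: powr_divide)
    ultimately show ?thesis
      by (simp add: \<omega>_def sum_distrib_right mult.assoc)
  qed
  moreover have "\<omega> j \<le> 0" if "0 < j" for j
    unfolding \<omega>_def
    using ab that
    by (intro sum_nonpos mult_nonneg_nonpos binomial_weight_nonpos divide_nonneg_nonneg)
      (force intro: less_imp_le)+
  ultimately show ?thesis unfolding generating_weights_def by blast
qed

text \<open>The sum over the exponents becomes an integral over \<alpha>, and uniform convergence in
  \<alpha> allows the power series to be integrated term by term.\<close>

lemma distributed_generating_weights:
  assumes "char_fun_distributed P" and \<tau>: "0 < \<tau>"
  shows "\<exists>\<omega>. generating_weights P \<tau> \<omega> \<and> (\<forall>j>0. \<omega> j \<le> 0)"
proof -
  obtain \<mu> where \<mu>: "\<forall>\<alpha>\<in>{0..1}. 0 \<le> \<mu> \<alpha>" and hoelder: "hoelder_continuous_on {0..1} \<mu>"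
    and P: "\<forall>z>0. P z = integral {0..1} (\<lambda>\<alpha>. z powr \<alpha> * \<mu> \<alpha>)"
    using assms unfolding char_fun_distributed_def by blast
  have cont_\<mu>[continuous_intros]: "continuous_on {0..1} \<mu>"
    by (rule hoelder_continuous_on_imp_continuous_on[OF hoelder])
  define \<nu> where "\<nu> \<alpha> = \<mu> \<alpha> / \<tau> powr \<alpha>" for \<alpha>
  have cont_\<nu>[continuous_intros]: "continuous_on {0..1} \<nu>"
    unfolding \<nu>_def using \<tau> by (intro continuous_intros) auto
  have \<nu>_nonneg: "0 \<le> \<nu> \<alpha>" if "\<alpha> \<in> {0..1}" for \<alpha>
    using \<mu> that by (simp add: \<nu>_def)
  obtain B where B: "\<And>\<alpha>. \<alpha> \<in> {0..1} \<Longrightarrow> \<bar>\<nu> \<alpha>\<bar> \<le> B"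
    using compact_imp_bounded[OF compact_continuous_image[OF cont_\<nu>]]
    by (force simp: bounded_iff)
  have cont_w: "continuous_on {0..1} (\<lambda>\<alpha>. binomial_weight \<alpha> j * \<nu> \<alpha>)" for j
    by (intro continuous_intros)
  define \<omega> where "\<omega> j = integral {0..1} (\<lambda>\<alpha>. binomial_weight \<alpha> j * \<nu> \<alpha>)" for j
  have \<omega>: "((\<lambda>\<alpha>. binomial_weight \<alpha> j * \<nu> \<alpha>) has_integral \<omega> j) {0..1}" for j
    unfolding \<omega>_def by (intro integrable_integral integrable_continuous_real cont_w)
  have "(\<lambda>j. \<omega> j * \<xi> ^ j) sums P ((1 - \<xi>) / \<tau>)" if \<xi>: "\<bar>\<xi>\<bar> < 1" for \<xi>
  proof -
    define g where "g j \<alpha> = binomial_weight \<alpha> j * \<nu> \<alpha> * \<xi> ^ j" for j \<alpha>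
    \<comment> \<open>The binomial weights are bounded by 1 and \<nu> by B, so the geometric series
      B |\<xi>|^j is a majorant.\<close>
    have "uniform_limit {0..1} (\<lambda>n \<alpha>. \<Sum>j<n. g j \<alpha>) (\<lambda>\<alpha>. \<Sum>j. g j \<alpha>) sequentially"
    proof (rule Weierstrass_m_test)
      show "summable (\<lambda>j. B * \<bar>\<xi>\<bar> ^ j)" using \<xi> by (intro summable_mult summable_geometric) auto
      fix j and \<alpha> :: real assume \<alpha>: "\<alpha> \<in> {0..1}"
      have "\<bar>binomial_weight \<alpha> j\<bar> * \<bar>\<nu> \<alpha>\<bar> \<le> 1 * B"
        using \<alpha> by (intro mult_mono abs_binomial_weight_le_1 B) auto
      then show "norm (g j \<alpha>) \<le> B * \<bar>\<xi>\<bar> ^ j"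
        by (simp add: g_def abs_mult power_abs mult_right_mono)
    qed
    moreover have "continuous_on {0..1} (\<lambda>\<alpha>. \<Sum>j<n. g j \<alpha>)" for n
      unfolding g_def by (intro continuous_intros)
    \<comment> \<open>The integrals \<open>I n\<close> of the partial sums converge to the integral
      \<open>J\<close> of the limit; it remains to identify \<open>I n\<close> with the partial sums
      of the weights and \<open>J\<close> with the value of P.\<close>
    ultimately obtain I J where
      I: "\<And>n. ((\<lambda>\<alpha>. \<Sum>j<n. g j \<alpha>) has_integral I n) {0..1}"
      and J: "((\<lambda>\<alpha>. \<Sum>j. g j \<alpha>) has_integral J) {0..1}" and IJ: "I \<longlonglongrightarrow> J"
      by (metis cbox_interval sequentially_bot uniform_limit_integral_cbox)
    have "((\<lambda>\<alpha>. \<Sum>j<n. g j \<alpha>) has_integral (\<Sum>j<n. \<omega> j * \<xi> ^ j)) {0..1}" for n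
      unfolding g_def by (intro has_integral_sum has_integral_mult_left \<omega>) auto
    then have "I = (\<lambda>n. \<Sum>j<n. \<omega> j * \<xi> ^ j)"
      using I has_integral_unique by blast
    moreover have "(\<Sum>j. g j \<alpha>) = ((1 - \<xi>) / \<tau>) powr \<alpha> * \<mu> \<alpha>" for \<alpha>
    proof -
      have "(\<lambda>j. binomial_weight \<alpha> j * \<xi> ^ j * \<nu> \<alpha>) sums ((1 - \<xi>) powr \<alpha> * \<nu> \<alpha>)"
        by (intro sums_mult2 binomial_weight_sums \<xi>)
      then show ?thesis
        using \<xi> \<tau> by (simp add: g_def \<nu>_def powr_divide sums_iff mult_ac)
    qed
    then have "J = P ((1 - \<xi>) / \<tau>)"
      using J \<xi> \<tau> P by (simp add: integral_unique)
    ultimately show ?thesis using IJ by (simp add: sums_def)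
  qed
  moreover have "\<omega> j \<le> 0" if "0 < j" for j
    using that binomial_weight_nonpos \<nu>_nonneg
    by (intro has_integral_le[OF \<omega> has_integral_0] mult_nonpos_nonneg) auto
  ultimately show ?thesis unfolding generating_weights_def by blast
qed

text \<open>One bound with two uses: P is positive on positive arguments, and P is unbounded at
  infinity. Case I keeps the term i = 1; Case II keeps the exponents near 1, with a = 1/2.\<close>

lemma characteristic_function_lower:
  assumes "characteristic_function P"
  obtains \<kappa> a :: real where "0 < \<kappa>" "0 < a" "\<And>z. 0 < z \<Longrightarrow> \<kappa> * min z (z powr a) \<le> P z"
  using assms unfolding characteristic_function_def
proof
  assume "char_fun_multi_term P"
  then obtain m and \<alpha> b :: "nat \<Rightarrow> real" where m: "1 \<le> m"
    and ab: "\<forall>i\<in>{1..m}. 0 < \<alpha> i \<and> \<alpha> i < 1 \<and> 0 < b i"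
    and P: "\<forall>z>0. P z = (\<Sum>i=1..m. b i * z powr \<alpha> i)"
    unfolding char_fun_multi_term_def by blast
  show thesis
  proof (rule that)
    show "0 < b 1" "0 < \<alpha> 1" using ab m by auto
    fix z :: real assume z: "0 < z"
    have "b 1 * min z (z powr \<alpha> 1) \<le> b 1 * z powr \<alpha> 1"
      using \<open>0 < b 1\<close> by simp
    also have "\<dots> \<le> (\<Sum>i=1..m. b i * z powr \<alpha> i)"
      using ab m by (intro member_le_sum[of 1 _ "\<lambda>i. b i * z powr \<alpha> i"]) (force simp: less_imp_le)+
    finally show "b 1 * min z (z powr \<alpha> 1) \<le> P z" using P z by simp
  qed
next
  assume "char_fun_distributed P"
  then obtain \<mu> where \<mu>: "\<forall>\<alpha>\<in>{0..1}. 0 \<le> \<mu> \<alpha>" and hoelder: "hoelder_continuous_on {0..1} \<mu>"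
    and prod: "0 < \<mu> 0 * \<mu> 1"
    and P: "\<forall>z>0. P z = integral {0..1} (\<lambda>\<alpha>. z powr \<alpha> * \<mu> \<alpha>)"
    unfolding char_fun_distributed_def by blast
  have \<mu>1: "0 < \<mu> 1" using prod \<mu> by (force simp: zero_less_mult_iff)
  have cont_\<mu>[continuous_intros]: "continuous_on {0..1} \<mu>"
    by (rule hoelder_continuous_on_imp_continuous_on[OF hoelder])
  then obtain d where d: "0 < d" "\<And>\<alpha>. \<alpha> \<in> {0..1} \<Longrightarrow> dist \<alpha> 1 < d \<Longrightarrow> dist (\<mu> \<alpha>) (\<mu> 1) < \<mu> 1 / 2"
    unfolding continuous_on_iff using \<mu>1 by (metis atLeastAtMost_iff half_gt_zero zero_le_one order_refl)
  \<comment> \<open>e < d keeps \<mu> above \<mu>(1)/2 on [1 - e, 1], and e \<le> 1/2 keeps that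
    interval inside [1/2, 1].\<close>
  define e where "e = min (d / 2) (1 / 2)"
  have e: "0 < e" "e \<le> 1 / 2" "e < d" using d by (auto simp: e_def)
  have low: "\<mu> 1 / 2 \<le> \<mu> \<alpha>" if "\<alpha> \<in> {1 - e..1}" for \<alpha>
  proof -
    have "dist (\<mu> \<alpha>) (\<mu> 1) < \<mu> 1 / 2"
      using that e by (intro d(2)) (auto simp: dist_real_def)
    then show ?thesis unfolding dist_real_def by linarith
  qed
  show thesis
  proof (rule that)
    show "0 < e * (\<mu> 1 / 2)" "0 < (1 / 2 :: real)" using e \<mu>1 by auto
    fix z :: real assume z: "0 < z"
    define q where "q = min z (z powr (1 / 2))"
    have q: "0 < q" using z by (simp add: q_def)
    \<comment> \<open>Over exponents in [1/2, 1] the smallest power of z is z^(1/2) if z \<ge> 1,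
      and z itself if z < 1.\<close>
    have zq: "q \<le> z powr \<alpha>" if "\<alpha> \<in> {1 - e..1}" for \<alpha>
    proof (cases "1 \<le> z")
      case True
      have "q \<le> z powr (1 / 2)" by (simp add: q_def)
      also have "\<dots> \<le> z powr \<alpha>" using that e True by (intro powr_mono) auto
      finally show ?thesis .
    next
      case False
      have "q \<le> z powr 1" using z by (simp add: q_def)
      also have "\<dots> \<le> z powr \<alpha>" using that False z by (intro powr_mono') auto
      finally show ?thesis .
    qed
    have int: "(\<lambda>\<alpha>. z powr \<alpha> * \<mu> \<alpha>) integrable_on {0..1}"
      using z by (intro integrable_continuous_real continuous_intros) auto
    have int': "(\<lambda>\<alpha>. z powr \<alpha> * \<mu> \<alpha>) integrable_on {1 - e..1}"
      by (rule integrable_on_subinterval[OF int]) (use e in auto)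
    have "e * (\<mu> 1 / 2) * q = integral {1 - e..1} (\<lambda>\<alpha>. q * (\<mu> 1 / 2))"
      using e by simp
    also have "\<dots> \<le> integral {1 - e..1} (\<lambda>\<alpha>. z powr \<alpha> * \<mu> \<alpha>)"
      using zq low q \<mu>1 by (intro integral_le int' mult_mono) auto
    also have "\<dots> \<le> integral {0..1} (\<lambda>\<alpha>. z powr \<alpha> * \<mu> \<alpha>)"
      using e \<mu> by (intro integral_subset_le int int') auto
    finally show "e * (\<mu> 1 / 2) * min z (z powr (1 / 2)) \<le> P z"
      using P z by (simp add: q_def)
  qed
qed

lemma weights_properties:
  assumes P: "characteristic_function P" and \<tau>: "0 < \<tau>"
  shows "weights P \<tau> 0 = P (1 / \<tau>)" "0 < weights P \<tau> 0"
    "\<And>j. 0 < j \<Longrightarrow> weights P \<tau> j \<le> 0" "\<And>n. 0 \<le> (\<Sum>j\<le>n. weights P \<tau> j)"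
proof -
  obtain \<omega> where \<omega>: "generating_weights P \<tau> \<omega>" "\<And>j. 0 < j \<Longrightarrow> \<omega> j \<le> 0"
    using P multi_term_generating_weights[OF _ \<tau>] distributed_generating_weights[OF _ \<tau>]
    unfolding characteristic_function_def by blast
  obtain \<kappa> a :: real where \<kappa>: "0 < \<kappa>" "0 < a" "\<And>z. 0 < z \<Longrightarrow> \<kappa> * min z (z powr a) \<le> P z"
    using characteristic_function_lower[OF P] by blast
  have pos: "0 < P z" if "0 < z" for z
  proof -
    have "0 < \<kappa> * min z (z powr a)" using \<kappa> that by simp
    with \<kappa>(3)[OF that] show ?thesis by linarith
  qed
  have w: "weights P \<tau> = \<omega>" by (rule weights_eqI[OF \<omega>(1)])
  show "weights P \<tau> 0 = P (1 / \<tau>)" "0 < weights P \<tau> 0"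
    using generating_weights_0[OF \<omega>(1)] pos[of "1 / \<tau>"] \<tau> by (simp_all add: w)
  show "weights P \<tau> j \<le> 0" if "0 < j" for j using \<omega>(2)[OF that] by (simp add: w)
  show "0 \<le> (\<Sum>j\<le>n. weights P \<tau> j)" for n
    unfolding w using pos
    by (intro generating_weights_partial_sum_nonneg[OF \<omega>(1) \<tau>] \<omega>(2)) (auto intro: less_imp_le)
qed

lemma weights_0_unbounded:
  assumes P: "characteristic_function P"
  shows "\<exists>\<tau>>0. B < weights P \<tau> 0"
proof -
  obtain \<kappa> a :: real where \<kappa>: "0 < \<kappa>" "0 < a" "\<And>z. 0 < z \<Longrightarrow> \<kappa> * min z (z powr a) \<le> P z"
    using characteristic_function_lower[OF P] by blast
  \<comment> \<open>\<kappa> y = |B| + 1 exceeds B. The choice of z below gives both z \<ge> y and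
    z^a \<ge> y, and the time step is 1/z.\<close>
  define y where "y = (\<bar>B\<bar> + 1) / \<kappa>"
  have y: "0 < y" "B < \<kappa> * y" using \<kappa> by (auto simp: y_def)
  define z where "z = max y (y powr (1 / a))"
  have z: "0 < z" using y by (simp add: z_def)
  have "y = (y powr (1 / a)) powr a" using y \<kappa> by (simp add: powr_powr)
  also have "\<dots> \<le> z powr a" using \<kappa> by (intro powr_mono2) (auto simp: z_def)
  finally have "y \<le> min z (z powr a)" by (simp add: z_def)
  then have "\<kappa> * y \<le> \<kappa> * min z (z powr a)" using \<kappa> by simp
  also have "\<dots> \<le> P z" by (rule \<kappa>(3)[OF z])
  finally have "B < weights P (1 / z) 0"
    using weights_properties(1)[OF P, of "1 / z"] y z by simp
  then show ?thesis using z by (intro exI[of _ "1 / z"]) auto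
qed

section \<open>The lumped mass matrix\<close>

text \<open>A triangle spans the plane, so its nonempty relative interior is its interior, and a set
  with nonempty interior is not negligible.\<close>

lemma two_simplex_measure_pos:
  fixes K :: "(real^2) set"
  assumes "2 simplex K"
  shows "0 < measure lebesgue K"
proof -
  have "affine hull K = UNIV"
    using aff_dim_simplex[OF assms] by (simp flip: aff_dim_eq_full)
  then have "rel_interior K = interior K" by (rule rel_interior_interior)
  moreover have "K \<noteq> {}" using assms by auto
  ultimately have "interior K \<noteq> {}"
    using convex_simplex[OF assms] rel_interior_eq_empty by metis
  then have "\<not> negligible K"
    using convex_simplex[OF assms] by (simp add: negligible_convex_interior)
  moreover have "K \<in> lmeasurable"
    using compact_simplex[OF assms] by (rule lmeasurable_compact)
  ultimately show ?thesis
    using negligible_iff_measure0 by (metis measure_nonneg order_le_less)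
qed

lemma finite_vertices_simplex:
  assumes "n simplex K"
  shows "finite (vertices K)"
  unfolding vertices_def
  using assms finite_polyhedron_extreme_points simplex_imp_polyhedron by blast

text \<open>The lumped product samples functions only at vertices. A vertex is either an interior
  node, where exactly one basis function is nonzero, or a boundary point, where all vanish.\<close>

lemma LM_mass_matrix_diagonal:
  fixes p :: "'n::finite \<Rightarrow> real^2"
  assumes \<Omega>: "open \<Omega>" and tri: "triangulation_of \<Omega> \<T>"
    and p: "bij_betw p UNIV (interior_nodes \<Omega> \<T>)" and \<phi>: "nodal_basis \<Omega> \<T> p \<phi>"
  obtains m where "\<And>i. 0 < m i"
    "LM_mass_matrix \<T> \<phi> = (\<chi> i j. if i = j then m i else 0)"
proof -
  have nodal: "\<phi> i (p j) = (if i = j then 1 else 0)" for i j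
    using \<phi> by (simp add: nodal_basis_def)
  have val: "\<phi> j q * \<phi> i q = 0" if "i \<noteq> j" "K \<in> \<T>" "q \<in> vertices K" for i j q K
  proof (cases "q \<in> \<Omega>")
    case True
    then have "q \<in> interior_nodes \<Omega> \<T>" using that by (auto simp: interior_nodes_def)
    then obtain k where "q = p k" using p by (auto simp: bij_betw_def)
    with that(1) show ?thesis by (auto simp: nodal)
  next
    case False
    have "q \<in> K" using that by (simp add: vertices_def extreme_point_of_def)
    then have "q \<in> closure \<Omega>" using tri that by (auto simp: triangulation_of_def)
    then have "q \<in> frontier \<Omega>" using False \<Omega> by (simp add: frontier_def interior_open)
    then show ?thesis using \<phi> by (simp add: nodal_basis_def fe_space_def)
  qed
  have fin: "finite \<T>" and simp: "\<And>K. K \<in> \<T> \<Longrightarrow> 2 simplex K"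
    using tri by (auto simp: triangulation_of_def triangulation_def)
  have off: "lumped_inner \<T> (\<phi> j) (\<phi> i) = 0" if "i \<noteq> j" for i j
    unfolding lumped_inner_def using val[OF that] by (simp add: sum.neutral)
  have pos: "0 < lumped_inner \<T> (\<phi> i) (\<phi> i)" for i
  proof -
    have "p i \<in> interior_nodes \<Omega> \<T>" using p by (auto simp: bij_betw_def)
    then obtain K where K: "K \<in> \<T>" "p i \<in> vertices K" by (auto simp: interior_nodes_def)
    show ?thesis
      unfolding lumped_inner_def
    proof (rule sum_pos2[OF fin K(1)])
      \<comment> \<open>A triangle having \<open>p i\<close> as a vertex contributes strictly, since
        \<open>\<phi> i\<close> equals 1 there.\<close>
      have "0 < (\<Sum>q\<in>vertices K. \<phi> i q * \<phi> i q)"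
        by (rule sum_pos2[OF finite_vertices_simplex[OF simp[OF K(1)]] K(2)]) (auto simp: nodal)
      then show "0 < 1 / 3 * measure lebesgue K * (\<Sum>q\<in>vertices K. \<phi> i q * \<phi> i q)"
        using two_simplex_measure_pos[OF simp[OF K(1)]] by simp
    qed (simp add: sum_nonneg)
  qed
  show thesis
    by (rule that[of "\<lambda>i. lumped_inner \<T> (\<phi> i) (\<phi> i)"])
      (use off pos in \<open>auto simp: LM_mass_matrix_def vec_eq_iff\<close>)
qed

lemma diagonal_matrix_mult_nth:
  fixes A :: "real^'m^'n"
  shows "((\<chi> i j. if i = j then d i else 0) ** A) $ i $ j = d i * A $ i $ j"
proof -
  have "(\<Sum>k\<in>UNIV. (if i = k then d i else 0) * A $ k $ j)
      = (\<Sum>k\<in>UNIV. if i = k then d k * A $ k $ j else 0)"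
    by (rule sum.cong) auto
  then show ?thesis by (simp add: matrix_matrix_mult_def)
qed

text \<open>\<open>matrix_inv\<close> is some inverse obtained by choice; multiplying it by D E = 1
  identifies it with E.\<close>

lemma matrix_inv_diagonal:
  fixes m :: "'n::finite \<Rightarrow> real"
  assumes m: "\<And>i. m i \<noteq> 0"
  shows "matrix_inv (\<chi> i j. if i = j then m i else 0) = (\<chi> i j. if i = j then 1 / m i else 0)"
    (is "matrix_inv ?D = ?E")
proof -
  have DE: "?D ** ?E = mat 1" and ED: "?E ** ?D = mat 1"
    using m by (auto simp: vec_eq_iff diagonal_matrix_mult_nth mat_def)
  have "invertible ?D" using DE ED by (auto simp: invertible_def)
  then have "matrix_inv ?D = matrix_inv ?D ** (?D ** ?E)" "matrix_inv ?D ** ?D = mat 1"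
    by (simp_all add: DE matrix_inv_works)
  then show ?thesis by (simp add: matrix_mul_assoc)
qed

text \<open>Multiplication by the inverse mass matrix divides row i by m_i > 0, which preserves the
  inequality for that row.\<close>

lemma diagonally_dominant_LM_matrix_iff:
  fixes p :: "'n::finite \<Rightarrow> real^2"
  assumes "open \<Omega>" "triangulation_of \<Omega> \<T>"
    "bij_betw p UNIV (interior_nodes \<Omega> \<T>)" "nodal_basis \<Omega> \<T> p \<phi>"
  shows "diagonally_dominant (LM_matrix \<Omega> \<T> \<phi>) \<longleftrightarrow> diagonally_dominant (stiffness_matrix \<Omega> \<phi>)"
proof -
  obtain m where m: "\<And>i. 0 < m i" and M: "LM_mass_matrix \<T> \<phi> = (\<chi> i j. if i = j then m i else 0)"
    using LM_mass_matrix_diagonal[OF assms] by blast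
  define S where "S = stiffness_matrix \<Omega> \<phi>"
  have "m i \<noteq> 0" for i using m[of i] by simp
  then have "LM_matrix \<Omega> \<T> \<phi> = (\<chi> i j. if i = j then 1 / m i else 0) ** S"
    by (simp add: LM_matrix_def M matrix_inv_diagonal S_def)
  then have H: "LM_matrix \<Omega> \<T> \<phi> $ i $ j = S $ i $ j / m i" for i j
    by (simp add: diagonal_matrix_mult_nth)
  have "(\<Sum>j\<in>UNIV - {i}. \<bar>S $ i $ j / m i\<bar>) \<le> S $ i $ i / m i
      \<longleftrightarrow> (\<Sum>j\<in>UNIV - {i}. \<bar>S $ i $ j\<bar>) \<le> S $ i $ i" for i
    using m[of i] by (simp add: divide_le_cancel flip: sum_divide_distrib)
  then show ?thesis
    unfolding diagonally_dominant_def H S_def[symmetric] by (rule iff_allI)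
qed

theorem theoremB1:
  fixes P :: "real \<Rightarrow> real"
    and \<Omega> :: "(real^2) set"
    and F :: "(real^2) set set set"
    and \<T> :: "(real^2) set set"
    and p :: "'n::finite \<Rightarrow> real^2"
    and \<phi> :: "'n \<Rightarrow> real^2 \<Rightarrow> real"
  assumes "characteristic_function P"
    and "polygonal_domain \<Omega>"
    and "\<And>\<T>'. \<T>' \<in> F \<Longrightarrow> triangulation_of \<Omega> \<T>'"
    and "shape_regular F" and "quasi_uniform F"
    and "\<T> \<in> F"
    and "bij_betw p UNIV (interior_nodes \<Omega> \<T>)"
    and "nodal_basis \<Omega> \<T> p \<phi>"
  shows "(diagonally_dominant (stiffness_matrix \<Omega> \<phi>) \<longrightarrow>
            (\<forall>\<tau>>0. \<forall>n. max_norm_contractive (solution_matrix (weights P \<tau>) (LM_matrix \<Omega> \<T> \<phi>) n)))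
       \<and> ((\<forall>\<tau>>0. max_norm_contractive (solution_matrix (weights P \<tau>) (LM_matrix \<Omega> \<T> \<phi>) 1)) \<longrightarrow>
            diagonally_dominant (stiffness_matrix \<Omega> \<phi>))"
proof -
  define H where "H = LM_matrix \<Omega> \<T> \<phi>"
  have "open \<Omega>" using assms(2) by (simp add: polygonal_domain_def)
  then have dd: "diagonally_dominant (stiffness_matrix \<Omega> \<phi>) \<longleftrightarrow> diagonally_dominant H"
    using diagonally_dominant_LM_matrix_iff[OF _ assms(3)[OF assms(6)] assms(7,8)]
    by (simp add: H_def)
  note w = weights_properties[OF assms(1)]
  have "max_norm_contractive (solution_matrix (weights P \<tau>) H n)"
    if "diagonally_dominant H" "0 < \<tau>" for \<tau> n
    unfolding max_norm_contractive_def solution_matrix_works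
    using infnorm_discrete_solution_le[OF that(1) w(2-4)[OF that(2)]] by blast
  moreover have "diagonally_dominant H"
    if con: "\<forall>\<tau>>0. max_norm_contractive (solution_matrix (weights P \<tau>) H 1)"
  proof (rule diagonally_dominant_if_resolvents_contractive)
    fix B
    \<comment> \<open>A suitable time step pushes the shift \<omega>_0 beyond B, and contractivity
      of the first solution matrix for that step is the required resolvent bound.\<close>
    obtain \<tau> where "0 < \<tau>" "B < weights P \<tau> 0"
      using weights_0_unbounded[OF assms(1)] by blast
    with con show "\<exists>c>B. \<forall>V. infnorm (matrix_inv (c *\<^sub>R mat 1 + H) *v (c *\<^sub>R V)) \<le> infnorm V"
      unfolding max_norm_contractive_def solution_matrix_works discrete_solution_1 by blast
  qed
  ultimately show ?thesis unfolding dd H_def[symmetric] by blast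
qed

end
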